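(* Assume $u(t_n)=u_n$ and that the Krylov approximation error satisfies $\tilde p_{\tau}g_n-p_{\tau}g_n=O(\tau^3)$ as $\tau\to 0$. Then, for any number $S\ge 1$ of substeps, the local error $u(t_n+\Delta t)-u_{n+1}$ of the ETD1 Krylov recycling scheme is second order, i.e. it is $O(\Delta t^2)$. Moreover, the local error after $j$ substeps ($1\le j\le S$) is $$u(t_n+j\,\delta t)-u_{n+\frac{j}{S}}=\frac{(j\,\delta t)^2}{2}\left(I-\frac{j-1}{j}V_mV_m^T\right)\frac{dF}{dt}(t_n,u_n)+O(\delta t^3).$$ In particular $$u(t_n+\Delta t)-u_{n+1}=\frac{\delta t^2}{2}\left(S^2 I-S(S-1)V_mV_m^T\right)\frac{dF}{dt}(t_n,u_n)+O(\delta t^3),$$ or, in terms of $\Delta t$, $$u(t_n+\Delta t)-u_{n+1}=\frac{\Delta t^2}{2}\left(I-\frac{S-1}{S}V_mV_m^T\right)\frac{dF}{dt}(t_n,u_n)+O(\Delta t^3).$$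
   Context: Let $L\in\mathbb{R}^{N\times N}$, let $F:[0,\infty)\times\mathbb{R}^N\to\mathbb{R}^N$ be twice continuously differentiable, and let $u(t)$ be the exact solution of the semilinear system $\frac{du}{dt}=Lu+F(t,u(t))$ with $u(t_n)=u_n$, where $t_n\ge 0$ and $u_n\in\mathbb{R}^N$ are fixed. Put $F_n=F(t_n,u_n)$ and $g_n=Lu_n+F_n$. The total derivative of $F$ along the solution at $(t_n,u_n)$ is $\frac{dF}{dt}(t_n,u_n)=\frac{\partial F}{\partial t}(t_n,u_n)+\frac{\partial F}{\partial u}(t_n,u_n)\,g_n$. For a square matrix $z$, $\varphi_1(z)=\sum_{k=0}^\infty \frac{z^k}{(k+1)!}$ (so $z\varphi_1(z)=e^z-I$). Let $m\ge1$ and let $\mathcal{K}_m(L,g_n)=\mathrm{span}\{g_n,Lg_n,\dots,L^{m-1}g_n\}$ be the Krylov subspace, assumed of dimension $m$. The Arnoldi algorithm produces $V_m\in\mathbb{R}^{N\times m}$, whose columns are an orthonormal basis of $\mathcal{K}_m(L,g_n)$ (so $V_m^TV_m=I$), and $H_m=V_m^TLV_m\in\mathbb{R}^{m\times m}$. For $\tau\in\mathbb{R}$ put $p_\tau=\tau\varphi_1(\tau L)$ and $\tilde p_\tau=\tau V_m\varphi_1(\tau H_m)V_m^T$. Recycling scheme: given $\Delta t>0$ and an integer $S\ge1$, put $\delta t=\Delta t/S$ and define $u_{n+\frac1S}=u_n+\tilde p_{\delta t}g_n$, and $u_{n+\frac jS}=u_{n+\frac{j-1}S}+\tilde p_{\delta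 t}\left(Lu_{n+\frac{j-1}S}+F_{n+\frac{j-1}S}\right)$ for $1<j\le S$, where $F_{n+\frac jS}=F(t_n+j\delta t,u_{n+\frac jS})$; the same $V_m,H_m$ (computed from $g_n$) are used for all substeps. Finally $u_{n+1}=u_{n+\frac SS}$. The $O$-symbols refer to $\Delta t\to0$ (equivalently $\delta t\to 0$) with $L,F,t_n,u_n,m,S,j$ (hence $V_m,H_m$) fixed. *)

theory Defs
  imports "HOL-Analysis.Analysis" "HOL-Library.Landau_Symbols"
begin

text \<open>Powers with respect to the matrix product; the operations \<open>*\<close> and \<open>^\<close> that the
  library provides on \<open>real ^ 'n ^ 'n\<close> act componentwise.\<close>

primrec matrix_power :: "real ^ 'n ^ 'n \<Rightarrow> nat \<Rightarrow> real ^ 'n ^ 'n" where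
  "matrix_power A 0 = mat 1"
| "matrix_power A (Suc k) = A ** matrix_power A k"

definition phi1 :: "real ^ 'n ^ 'n \<Rightarrow> real ^ 'n ^ 'n" where
  "phi1 A = (\<Sum>k. (1 / fact (k + 1)) *\<^sub>R matrix_power A k)"

definition krylov_space :: "real ^ 'n ^ 'n \<Rightarrow> real ^ 'n \<Rightarrow> nat \<Rightarrow> (real ^ 'n) set" where
  "krylov_space L g m = span {matrix_power L k *v g | k. k < m}"

definition orthonormal_basis_columns :: "real ^ 'm ^ 'n \<Rightarrow> (real ^ 'n) set \<Rightarrow> bool" where
  "orthonormal_basis_columns V W \<longleftrightarrow>
     (\<forall>i j. column i V \<bullet> column j V = (if i = j then 1 else 0)) \<and> span (columns V) = W"

text \<open>Derivatives are taken within \<open>S\<close>, hence one-sided on the boundary of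
  \<open>{0..} \<times> UNIV\<close>, where they are still unique.\<close>

definition twice_continuously_differentiable_on ::
    "('a::real_normed_vector \<Rightarrow> 'b::real_normed_vector) \<Rightarrow> 'a set \<Rightarrow> bool" where
  "twice_continuously_differentiable_on f S \<longleftrightarrow>
     (\<exists>(f' :: 'a \<Rightarrow> 'a \<Rightarrow>\<^sub>L 'b) (f'' :: 'a \<Rightarrow> 'a \<Rightarrow>\<^sub>L 'a \<Rightarrow>\<^sub>L 'b).
        (\<forall>x\<in>S. (f has_derivative blinfun_apply (f' x)) (at x within S)) \<and>
        (\<forall>x\<in>S. (f' has_derivative blinfun_apply (f'' x)) (at x within S)) \<and>
        continuous_on S f'')"

definition semilinear_rhs ::
    "real ^ 'n ^ 'n \<Rightarrow> (real \<Rightarrow> real ^ 'n \<Rightarrow> real ^ 'n) \<Rightarrow> real \<Rightarrow> real ^ 'n \<Rightarrow> real ^ 'n" where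
  "semilinear_rhs L F t v = L *v v + F t v"

text \<open>The time derivative is one-sided at \<open>t = 0\<close>, since \<open>F\<close> is only constrained for
  nonnegative times.\<close>

definition total_derivative ::
    "real ^ 'n ^ 'n \<Rightarrow> (real \<Rightarrow> real ^ 'n \<Rightarrow> real ^ 'n) \<Rightarrow> real \<Rightarrow> real ^ 'n \<Rightarrow> real ^ 'n" where
  "total_derivative L F t v =
     vector_derivative (\<lambda>s. F s v) (at t within {0..}) +
     frechet_derivative (\<lambda>w. F t w) (at v) (semilinear_rhs L F t v)"

definition exact_propagator :: "real ^ 'n ^ 'n \<Rightarrow> real \<Rightarrow> real ^ 'n ^ 'n" where
  "exact_propagator L \<tau> = \<tau> *\<^sub>R phi1 (\<tau> *\<^sub>R L)"

definition projected_matrix :: "real ^ 'n ^ 'n \<Rightarrow> real ^ 'm ^ 'n \<Rightarrow> real ^ 'm ^ 'm" where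
  "projected_matrix L V = transpose V ** L ** V"

definition krylov_propagator :: "real ^ 'n ^ 'n \<Rightarrow> real ^ 'm ^ 'n \<Rightarrow> real \<Rightarrow> real ^ 'n ^ 'n" where
  "krylov_propagator L V \<tau> =
     \<tau> *\<^sub>R (V ** phi1 (\<tau> *\<^sub>R projected_matrix L V) ** transpose V)"

text \<open>\<open>recycled_substep L F t0 u0 V \<delta> j\<close> is the approximation at time \<open>t0 + j * \<delta>\<close>; the first
  substep applies the propagator to \<open>L *v u0 + F t0 u0\<close>, the vector generating the Krylov space.\<close>

primrec recycled_substep ::
    "real ^ 'n ^ 'n \<Rightarrow> (real \<Rightarrow> real ^ 'n \<Rightarrow> real ^ 'n) \<Rightarrow> real \<Rightarrow> real ^ 'n \<Rightarrow> real ^ 'm ^ 'n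
      \<Rightarrow> real \<Rightarrow> nat \<Rightarrow> real ^ 'n" where
  "recycled_substep L F t0 u0 V \<delta> 0 = u0"
| "recycled_substep L F t0 u0 V \<delta> (Suc j) =
     recycled_substep L F t0 u0 V \<delta> j +
     krylov_propagator L V \<delta> *v
       semilinear_rhs L F (t0 + real j * \<delta>) (recycled_substep L F t0 u0 V \<delta> j)"

end

theory Submission
  imports Defs
begin

text \<open>The local error is the difference of two expansions in the substep length \<open>h\<close> up to order three.
Write \<open>g\<close> for the initial velocity, \<open>D\<close> for the total derivative of the nonlinearity at the
initial point and \<open>P = V ** transpose V\<close> for the orthogonal projection onto the Krylov space.

The exact solution satisfies \<open>u'' = L *v g + D\<close> at the initial time, hence
\<open>u (t + j * h) = u t + (j * h) *\<^sub>R g + ((j * h) ^ 2 / 2) *\<^sub>R (L *v g + D)\<close> up to order three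
(\<open>exact_solution_expansion\<close>). The remainder is that of the first-order Taylor polynomial of the vector
field along the solution, integrated once.

The Krylov propagator is \<open>h *\<^sub>R P + (h ^ 2 / 2) *\<^sub>R (P ** L ** P)\<close> up to order three
(\<open>krylov_propagator_expansion\<close>). It treats \<open>g\<close> and \<open>L *v g\<close> as the exact propagator does: \<open>g\<close>
lies in the Krylov space, and the assumed error bound forces \<open>P *v (L *v g) = L *v g\<close>
(\<open>krylov_error_imp_invariant\<close>). On \<open>D\<close>, which has no reason to lie in the Krylov space, it acts
through \<open>P\<close>. By induction (\<open>recycled_substep_expansion\<close>) the value after \<open>j\<close> substeps
has the second-order term
\<open>(h ^ 2 / 2) *\<^sub>R (j ^ 2 *\<^sub>R (L *v g) + (j * (j - 1)) *\<^sub>R (P *v D))\<close>. Subtracting, the terms with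
\<open>L *v g\<close> cancel and \<open>(h ^ 2 / 2) *\<^sub>R (j ^ 2 *\<^sub>R D - (j * (j - 1)) *\<^sub>R (P *v D))\<close> remains. All
claims are this formula, rewritten for the appropriate \<open>j\<close> and step size.\<close>

section \<open>Functions of a step size that vanish to a given order\<close>

text \<open>The error terms of the expansions below are vectors or matrices, and they are recombined by sums
and products, which a bound on norms alone does not follow. The predicate hides the norm, so that
errors can be treated as vectors whose orders are tracked by the closure rules. The filter
\<open>at_right 0\<close> fits positive step sizes: the powers \<open>h ^ k\<close> are positive there, and the solution is known for times after the initial one only.\<close>

definition vanishes_to_order :: "nat \<Rightarrow> (real \<Rightarrow> 'a::real_normed_vector) \<Rightarrow> bool" where
  "vanishes_to_order k f \<longleftrightarrow> (\<lambda>h. norm (f h)) \<in> O[at_right 0](\<lambda>h. h ^ k)"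

lemma vanishes_to_order_iff:
  "vanishes_to_order k f \<longleftrightarrow> (\<exists>C>0. eventually (\<lambda>h. norm (f h) \<le> C * h ^ k) (at_right 0))"
proof -
  have "eventually (\<lambda>h. norm (norm (f h)) \<le> C * norm (h ^ k)) (at_right 0) \<longleftrightarrow>
        eventually (\<lambda>h. norm (f h) \<le> C * h ^ k) (at_right 0)" for C
    by (rule eventually_cong[OF eventually_at_right_less[of 0]]) (simp add: power_abs)
  then show ?thesis
    unfolding vanishes_to_order_def bigo_def by simp
qed

lemma vanishes_to_orderI:
  assumes "eventually (\<lambda>h. norm (f h) \<le> C * h ^ k) (at_right 0)"
  shows "vanishes_to_order k f"
  unfolding vanishes_to_order_iff
proof (intro exI conjI)
  show "0 < \<bar>C\<bar> + 1" by simp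
  show "eventually (\<lambda>h. norm (f h) \<le> (\<bar>C\<bar> + 1) * h ^ k) (at_right 0)"
    using assms eventually_at_right_less[of 0]
  proof eventually_elim
    case (elim h)
    have "C * h ^ k \<le> (\<bar>C\<bar> + 1) * h ^ k"
      using elim by (intro mult_right_mono) auto
    with elim show ?case by linarith
  qed
qed

lemma vanishes_to_order_add:
  assumes "vanishes_to_order k f" "vanishes_to_order k g"
  shows "vanishes_to_order k (\<lambda>h. f h + g h)"
proof -
  from assms obtain A B where
    "eventually (\<lambda>h. norm (f h) \<le> A * h ^ k) (at_right 0)"
    "eventually (\<lambda>h. norm (g h) \<le> B * h ^ k) (at_right 0)"
    unfolding vanishes_to_order_iff by blast
  then have "eventually (\<lambda>h. norm (f h + g h) \<le> (A + B) * h ^ k) (at_right 0)"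
    by eventually_elim (simp add: distrib_right norm_triangle_mono)
  then show ?thesis by (rule vanishes_to_orderI)
qed

lemma vanishes_to_order_mono:
  assumes "vanishes_to_order k f" "l \<le> k"
  shows "vanishes_to_order l f"
proof -
  from assms obtain A where A: "A > 0"
    "eventually (\<lambda>h. norm (f h) \<le> A * h ^ k) (at_right 0)"
    unfolding vanishes_to_order_iff by blast
  have "eventually (\<lambda>h::real. h < 1) (at_right 0)"
    by (rule eventually_at_right_real[of 0 1, THEN eventually_mono]) auto
  with A(2) eventually_at_right_less[of 0]
  have "eventually (\<lambda>h. norm (f h) \<le> A * h ^ l) (at_right 0)"
  proof eventually_elim
    case (elim h)
    have "A * h ^ k \<le> A * h ^ l"
      using elim A(1) assms(2) by (intro mult_left_mono power_decreasing) auto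
    with elim show ?case by linarith
  qed
  then show ?thesis by (rule vanishes_to_orderI)
qed

text \<open>The step at which orders add up. It covers the scalar multiple \<open>h *\<^sub>R f h\<close> as well as
the product of a matrix and a vector that both depend on the step size.\<close>

lemma vanishes_to_order_bounded_bilinear:
  assumes "bounded_bilinear b" "vanishes_to_order k f" "vanishes_to_order l g"
  shows "vanishes_to_order (k + l) (\<lambda>h. b (f h) (g h))"
proof -
  from assms obtain A B where AB: "A > 0" "B > 0"
    "eventually (\<lambda>h. norm (f h) \<le> A * h ^ k) (at_right 0)"
    "eventually (\<lambda>h. norm (g h) \<le> B * h ^ l) (at_right 0)"
    unfolding vanishes_to_order_iff by blast
  obtain K where K: "K \<ge> 0" "\<And>x y. norm (b x y) \<le> norm x * norm y * K"
    using bounded_bilinear.nonneg_bounded[OF assms(1)] by blast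
  from AB(3,4) eventually_at_right_less[of 0]
  have "eventually (\<lambda>h. norm (b (f h) (g h)) \<le> (A * B * K) * h ^ (k + l)) (at_right 0)"
  proof eventually_elim
    case (elim h)
    have "norm (f h) * norm (g h) * K \<le> (A * h ^ k) * (B * h ^ l) * K"
      using elim AB(1,2) K(1) by (intro mult_right_mono mult_mono) auto
    with K(2)[of "f h" "g h"] show ?case
      by (simp add: power_add algebra_simps)
  qed
  then show ?thesis by (rule vanishes_to_orderI)
qed

lemma vanishes_to_order_bounded_linear:
  assumes "bounded_linear b" "vanishes_to_order k f"
  shows "vanishes_to_order k (\<lambda>h. b (f h))"
proof -
  from assms obtain A where A: "A > 0"
    "eventually (\<lambda>h. norm (f h) \<le> A * h ^ k) (at_right 0)"
    unfolding vanishes_to_order_iff by blast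
  obtain K where K: "K \<ge> 0" "\<And>x. norm (b x) \<le> norm x * K"
    using bounded_linear.nonneg_bounded[OF assms(1)] by blast
  from A(2) have "eventually (\<lambda>h. norm (b (f h)) \<le> (A * K) * h ^ k) (at_right 0)"
  proof eventually_elim
    case (elim h)
    have "norm (f h) * K \<le> (A * h ^ k) * K"
      using elim K(1) by (intro mult_right_mono)
    with K(2)[of "f h"] show ?case by (simp add: algebra_simps)
  qed
  then show ?thesis by (rule vanishes_to_orderI)
qed

lemma vanishes_to_order_minus:
  "vanishes_to_order k f \<Longrightarrow> vanishes_to_order k (\<lambda>h. - f h)"
  by (simp add: vanishes_to_order_def)

lemma vanishes_to_order_diff:
  assumes "vanishes_to_order k f" "vanishes_to_order k g"
  shows "vanishes_to_order k (\<lambda>h. f h - g h)"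
proof -
  have "vanishes_to_order k (\<lambda>h. - g h)"
    using assms(2) by (rule vanishes_to_order_minus)
  with assms(1) have "vanishes_to_order k (\<lambda>h. f h + - g h)"
    by (rule vanishes_to_order_add)
  then show ?thesis by (simp only: add_uminus_conv_diff)
qed

lemma vanishes_to_order_power:
  "vanishes_to_order k (\<lambda>h. h ^ k *\<^sub>R c)"
  by (rule vanishes_to_orderI[of _ "norm c"], rule eventually_mono[OF eventually_at_right_less[of 0]])
     (simp add: power_abs)

lemma vanishes_to_order_const: "vanishes_to_order 0 (\<lambda>h. c)"
  using vanishes_to_order_power[of 0 c] by simp

lemma vanishes_to_order_linear: "vanishes_to_order 1 (\<lambda>h. h *\<^sub>R c)"
  using vanishes_to_order_power[of 1 c] by simp

lemma vanishes_to_order_dilate: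
  assumes "vanishes_to_order k f" "0 < c"
  shows "vanishes_to_order k (\<lambda>h. f (c * h))"
proof -
  from assms obtain A where
    "eventually (\<lambda>h. norm (f h) \<le> A * h ^ k) (at_right 0)"
    unfolding vanishes_to_order_iff by blast
  moreover have "filterlim (\<lambda>h. c * h) (at_right 0) (at_right (0::real))"
    using filtermap_times_pos_at_right[OF assms(2), of 0] by (simp add: filterlim_def)
  ultimately have "eventually (\<lambda>h. norm (f (c * h)) \<le> A * (c * h) ^ k) (at_right 0)"
    by (rule eventually_compose_filterlim)
  then show ?thesis
    by (intro vanishes_to_orderI[of _ "A * c ^ k"]) (simp add: power_mult_distrib mult.assoc)
qed

text \<open>Coefficients of an expansion are determined by its values: this turns an error bound into an
identity between vectors.\<close>

lemma vanishes_to_order_Suc_power_iff: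
  "vanishes_to_order (Suc k) (\<lambda>h. h ^ k *\<^sub>R c) \<longleftrightarrow> c = 0"
proof
  assume "vanishes_to_order (Suc k) (\<lambda>h. h ^ k *\<^sub>R c)"
  then obtain A where A: "A > 0"
    "eventually (\<lambda>h. norm (h ^ k *\<^sub>R c) \<le> A * h ^ Suc k) (at_right 0)"
    unfolding vanishes_to_order_iff by blast
  from A(2) eventually_at_right_less[of 0]
  have "eventually (\<lambda>h. norm c \<le> A * h) (at_right 0)"
    by eventually_elim (simp add: power_abs field_simps)
  moreover have "((\<lambda>h. A * h) \<longlongrightarrow> A * 0) (at_right 0)"
    by (intro tendsto_intros)
  ultimately have "norm c \<le> A * 0"
    by (intro tendsto_lowerbound[of "\<lambda>h. A * h"]) auto
  then show "c = 0" by simp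
qed (simp add: vanishes_to_order_def)

section \<open>Integration and Taylor expansion\<close>

text \<open>By the mean value inequality \<open>f h\<close> is at most \<open>h\<close> times a value of \<open>f'\<close> at an intermediate
\<open>s\<close>, and \<open>A * s ^ k\<close> increases with \<open>s\<close>.\<close>

lemma vanishes_to_order_integrate:
  fixes f f' :: "real \<Rightarrow> 'a::real_inner"
  assumes "0 < T"
    and deriv: "\<And>h. h \<in> {0..<T} \<Longrightarrow> (f has_vector_derivative f' h) (at h within {0..<T})"
    and "f 0 = 0" and f': "vanishes_to_order k f'"
  shows "vanishes_to_order (Suc k) f"
proof -
  from f' obtain A where A: "A > 0" "eventually (\<lambda>h. norm (f' h) \<le> A * h ^ k) (at_right 0)"
    unfolding vanishes_to_order_iff by blast
  from A(2) obtain d where d: "d > 0" "\<And>h. 0 < h \<Longrightarrow> h < d \<Longrightarrow> norm (f' h) \<le> A * h ^ k"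
    unfolding eventually_at_right_field by blast
  have "norm (f h) \<le> A * h ^ Suc k" if h: "0 < h" "h < min d T" for h
  proof -
    have cont: "continuous_on {0..h} f"
      unfolding continuous_on_eq_continuous_within
    proof
      fix s assume s: "s \<in> {0..h}"
      show "continuous (at s within {0..h}) f"
        by (rule has_vector_derivative_continuous[OF has_vector_derivative_within_subset[OF deriv]])
           (use s h in auto)
    qed
    have "(f has_derivative (\<lambda>x. x *\<^sub>R f' s)) (at s)" if s: "0 < s" "s < h" for s
    proof -
      have "(f has_vector_derivative f' s) (at s within {0<..<T})"
        by (rule has_vector_derivative_within_subset[OF deriv]) (use s h in auto)
      then show ?thesis
        using s h by (simp add: has_vector_derivative_def at_within_open[of s "{0<..<T}"])
    qed
    from mvt_general[OF h(1) cont this] obtain s where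
      s: "0 < s" "s < h" "norm (f h - f 0) \<le> norm ((h - 0) *\<^sub>R f' s)" by auto
    have "A * s ^ k \<le> A * h ^ k"
      using s A(1) by (intro mult_left_mono power_mono) auto
    moreover have "norm (f' s) \<le> A * s ^ k"
      using s h by (intro d(2)) auto
    ultimately have "norm (f' s) \<le> A * h ^ k" by (rule order_trans[rotated])
    then have "h * norm (f' s) \<le> h * (A * h ^ k)" using h by (intro mult_left_mono) auto
    also have "\<dots> = A * h ^ Suc k" by simp
    finally have "h * norm (f' s) \<le> A * h ^ Suc k" .
    moreover have "norm (f h) \<le> h * norm (f' s)"
      using s(3) h(1) \<open>f 0 = 0\<close> by simp
    ultimately show ?thesis by (rule order_trans[rotated])
  qed
  then have "eventually (\<lambda>h. norm (f h) \<le> A * h ^ Suc k) (at_right 0)"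
    unfolding eventually_at_right_field using d(1) \<open>0 < T\<close> by (intro exI[of _ "min d T"]) simp
  then show ?thesis by (rule vanishes_to_orderI)
qed

text \<open>Differentiability of \<open>f'\<close> at the single point \<open>x\<close> bounds \<open>f' y - f' x\<close> near \<open>x\<close> by a
multiple of the distance from \<open>x\<close>; the mean value inequality on the segment from \<open>x\<close> to \<open>y\<close>, for \<open>f\<close> minus its
linearization, contributes the second factor. Derivatives within a convex set are enough, which
allows expansion points on the boundary \<open>t = 0\<close> of the domain of the nonlinearity.\<close>

lemma taylor_remainder_quadratic:
  fixes f :: "'a::real_normed_vector \<Rightarrow> 'b::real_normed_vector" and f' :: "'a \<Rightarrow> 'a \<Rightarrow>\<^sub>L 'b"
  assumes "convex S" "x \<in> S"
    and f': "\<And>y. y \<in> S \<Longrightarrow> (f has_derivative blinfun_apply (f' y)) (at y within S)"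
    and f'': "(f' has_derivative f'') (at x within S)"
  obtains C d where "d > 0"
    "\<And>y. y \<in> S \<Longrightarrow> norm (y - x) < d \<Longrightarrow> norm (f y - f x - f' x (y - x)) \<le> C * norm (y - x) ^ 2"
proof -
  have bl: "bounded_linear f''" using f'' by (rule has_derivative_bounded_linear)
  obtain K where K: "K \<ge> 0" "\<And>z. norm (f'' z) \<le> norm z * K"
    using bounded_linear.nonneg_bounded[OF bl] by blast
  obtain d where d: "d > 0" "\<And>y. y \<in> S \<Longrightarrow> norm (y - x) < d \<Longrightarrow>
      norm (f' y - f' x - f'' (y - x)) \<le> 1 * norm (y - x)"
    using f'' unfolding has_derivative_within_alt
    by (metis zero_less_one)
  have lip: "norm (f' y - f' x) \<le> (K + 1) * norm (y - x)" if "y \<in> S" "norm (y - x) < d" for y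
  proof -
    have "norm (f' y - f' x) \<le> norm (f' y - f' x - f'' (y - x)) + norm (f'' (y - x))"
      using norm_triangle_ineq[of "f' y - f' x - f'' (y - x)" "f'' (y - x)"] by simp
    with d(2)[OF that] K(2)[of "y - x"] show ?thesis by (simp add: algebra_simps)
  qed
  show ?thesis
  proof (rule that[OF d(1)])
    fix y assume y: "y \<in> S" "norm (y - x) < d"
    \<comment> \<open>Within the ball the derivative differs from \<open>f' x\<close> by a multiple of the distance of
      \<open>y\<close>, and the intersection is still convex.\<close>
    let ?U = "S \<inter> cball x (norm (y - x))"
    have "convex ?U" using \<open>convex S\<close> by (intro convex_Int convex_cball)
    moreover have xy: "x \<in> ?U" "y \<in> ?U"
      using y \<open>x \<in> S\<close> by (auto simp: dist_norm norm_minus_commute)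
    ultimately have seg: "x + t *\<^sub>R (y - x) \<in> ?U" if "t \<in> {0..1}" for t
      using that convexD_alt[of ?U x y t] by (simp add: algebra_simps)
    have "norm (f y - f x - f' x (y - x)) \<le> norm (y - x) * ((K + 1) * norm (y - x))"
    proof (rule differentiable_bound_linearization[of x y ?U f "\<lambda>z. blinfun_apply (f' z)" x,
            OF seg])
      show "(f has_derivative blinfun_apply (f' z)) (at z within ?U)" if "z \<in> ?U" for z
        using f'[of z] that by (auto intro: has_derivative_subset)
      show "onorm (blinfun_apply (f' z) - blinfun_apply (f' x)) \<le> (K + 1) * norm (y - x)" if "z \<in> ?U" for z
      proof -
        have z: "norm (z - x) \<le> norm (y - x)" "z \<in> S"
          using that by (auto simp: dist_norm norm_minus_commute)
        then have "norm (f' z - f' x) \<le> (K + 1) * norm (z - x)"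
          using y by (intro lip) auto
        also have "\<dots> \<le> (K + 1) * norm (y - x)"
          using z K(1) by (intro mult_left_mono) auto
        finally show ?thesis
          by (simp add: norm_blinfun.rep_eq minus_blinfun.rep_eq fun_diff_def)
      qed
    qed (use xy in auto)
    then show "norm (f y - f x - f' x (y - x)) \<le> (K + 1) * norm (y - x) ^ 2"
      by (simp add: power2_eq_square algebra_simps)
  qed
qed

lemma taylor_along_curve:
  fixes f :: "'a::real_normed_vector \<Rightarrow> 'b::real_normed_vector" and f' :: "'a \<Rightarrow> 'a \<Rightarrow>\<^sub>L 'b"
  assumes "convex S" "x \<in> S"
    and f': "\<And>y. y \<in> S \<Longrightarrow> (f has_derivative blinfun_apply (f' y)) (at y within S)"
    and f'': "(f' has_derivative f'') (at x within S)"
    and c: "eventually (\<lambda>h. c h \<in> S) (at_right 0)" "vanishes_to_order 1 (\<lambda>h. c h - x)"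
  shows "vanishes_to_order 2 (\<lambda>h. f (c h) - f x - f' x (c h - x))"
proof -
  obtain C d where d: "d > 0" "\<And>y. y \<in> S \<Longrightarrow> norm (y - x) < d \<Longrightarrow>
      norm (f y - f x - f' x (y - x)) \<le> C * norm (y - x) ^ 2"
    using taylor_remainder_quadratic[OF assms(1-4)] by blast
  from c(2) obtain A where A: "A > 0" "eventually (\<lambda>h. norm (c h - x) \<le> A * h) (at_right 0)"
    unfolding vanishes_to_order_iff by auto
  have "eventually (\<lambda>h::real. h < d / A) (at_right 0)"
    using A(1) d(1) by (intro eventually_at_right_real[of 0 "d / A", THEN eventually_mono]) auto
  with A(2) c(1) eventually_at_right_less[of 0]
  have "eventually (\<lambda>h. norm (f (c h) - f x - f' x (c h - x)) \<le> (\<bar>C\<bar> * A ^ 2) * h ^ 2) (at_right 0)"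
  proof eventually_elim
    case (elim h)
    have "norm (c h - x) < d"
      using elim A(1) by (auto simp: field_simps)
    with d(2) elim have "norm (f (c h) - f x - f' x (c h - x)) \<le> C * norm (c h - x) ^ 2" by blast
    also have "\<dots> \<le> \<bar>C\<bar> * (A * h) ^ 2"
      using elim by (intro mult_mono power_mono) auto
    finally show ?case by (simp add: power_mult_distrib algebra_simps)
  qed
  then show ?thesis by (rule vanishes_to_orderI)
qed

section \<open>The vector field and the exact solution\<close>

lemma at_within_Ici_neq_bot:
  fixes a t :: real
  assumes "a \<le> t"
  shows "at t within {a..} \<noteq> bot"
proof -
  have "at_right t \<le> at t within {a..}"
    using assms by (intro at_le) auto
  then show ?thesis
    using trivial_limit_at_right_real[of t] le_bot by metis
qed

lemma has_derivative_partial_fst: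
  assumes F': "((\<lambda>(t, v). F t v) has_derivative F') (at (t, v) within A \<times> UNIV)"
  shows "((\<lambda>s. F s v) has_derivative (\<lambda>s. F' (s, 0))) (at t within A)"
proof -
  have "((\<lambda>s. case (s, v) of (s, v) \<Rightarrow> F s v) has_derivative (\<lambda>s. F' (s, 0))) (at t within A)"
    by (rule has_derivative_in_compose[where f = "\<lambda>s. (s, v)"])
       (auto intro!: derivative_eq_intros has_derivative_subset[OF F'])
  then show ?thesis by simp
qed

lemma has_derivative_partial_snd:
  assumes F': "((\<lambda>(t, v). F t v) has_derivative F') (at (t, v) within A \<times> UNIV)" and t: "t \<in> A"
  shows "((\<lambda>w. F t w) has_derivative (\<lambda>w. F' (0, w))) (at v)"
proof -
  have "((\<lambda>w. case (t, w) of (t, w) \<Rightarrow> F t w) has_derivative (\<lambda>w. F' (0, w))) (at v)"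
    by (rule has_derivative_in_compose[where f = "\<lambda>w. (t, w)"])
       (use t in \<open>auto intro!: derivative_eq_intros has_derivative_subset[OF F']\<close>)
  then show ?thesis by simp
qed

text \<open>The chain rule identifies the joint derivative of the nonlinearity with the two partial
derivatives that occur in the total derivative; the time derivative is determined although it may
be one-sided.\<close>

lemma nonlinearity_expansion:
  fixes F :: "real \<Rightarrow> real ^ 'n \<Rightarrow> real ^ 'n"
  assumes F: "twice_continuously_differentiable_on (\<lambda>(t, v). F t v) ({0..} \<times> UNIV)"
    and t: "0 \<le> t" and c: "0 \<le> c" and w: "vanishes_to_order 1 (\<lambda>h. w h - v)"
  shows "vanishes_to_order 2 (\<lambda>h. F (t + c * h) (w h) - F t v
           - (c * h) *\<^sub>R vector_derivative (\<lambda>s. F s v) (at t within {0..})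
           - frechet_derivative (\<lambda>x. F t x) (at v) (w h - v))"
proof -
  let ?S = "{0..} \<times> (UNIV :: (real ^ 'n) set)"
  from F obtain F' :: "real \<times> (real ^ 'n) \<Rightarrow> (real \<times> (real ^ 'n)) \<Rightarrow>\<^sub>L (real ^ 'n)" and F'' where
    F': "\<And>x. x \<in> ?S \<Longrightarrow> ((\<lambda>(t, v). F t v) has_derivative blinfun_apply (F' x)) (at x within ?S)"
    and F'': "\<And>x. x \<in> ?S \<Longrightarrow> (F' has_derivative blinfun_apply (F'' x)) (at x within ?S)"
    unfolding twice_continuously_differentiable_on_def by blast
  have mem: "(t, v) \<in> ?S" using t by simp
  have "((\<lambda>s. F s v) has_derivative (\<lambda>s. F' (t, v) (s, 0))) (at t within {0..})"
    by (rule has_derivative_partial_fst[OF F'[OF mem]])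
  then have "((\<lambda>s. F s v) has_vector_derivative F' (t, v) (1, 0)) (at t within {0..})"
    unfolding has_vector_derivative_def
    by (simp flip: blinfun.scaleR_right)
  then have Dt: "vector_derivative (\<lambda>s. F s v) (at t within {0..}) = F' (t, v) (1, 0)"
    using t by (intro vector_derivative_within) (auto simp: at_within_Ici_neq_bot)
  have Dv: "frechet_derivative (\<lambda>x. F t x) (at v) = (\<lambda>x. F' (t, v) (0, x))"
    using has_derivative_partial_snd[OF F'[OF mem]] t by (intro frechet_derivative_at[symmetric]) simp
  have "vanishes_to_order 1 (\<lambda>h. h *\<^sub>R (c, 0) + (0, w h - v))"
    by (intro vanishes_to_order_add vanishes_to_order_linear
          vanishes_to_order_bounded_linear[of "\<lambda>x. (0, x)"] w) (auto intro!: bounded_linear_intros)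
  then have curve: "vanishes_to_order 1 (\<lambda>h. (t + c * h, w h) - (t, v))"
    by (simp add: mult.commute)
  have "eventually (\<lambda>h. (t + c * h, w h) \<in> ?S) (at_right 0)"
    using eventually_at_right_less[of 0] by eventually_elim (use t c in auto)
  from taylor_along_curve[OF _ mem F' F''[OF mem] this curve]
  have "vanishes_to_order 2 (\<lambda>h. F (t + c * h) (w h) - F t v - F' (t, v) (c * h, w h - v))"
    by (simp add: convex_Times)
  also have "(\<lambda>h. F' (t, v) (c * h, w h - v)) =
      (\<lambda>h. (c * h) *\<^sub>R F' (t, v) (1, 0) + F' (t, v) (0, w h - v))"
    by (simp flip: blinfun.scaleR_right blinfun.add_right)
  finally show ?thesis by (simp add: Dt Dv diff_diff_eq add.assoc)
qed

lemma frechet_derivative_bounded_linear_of_C2: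
  fixes F :: "real \<Rightarrow> real ^ 'n \<Rightarrow> real ^ 'n"
  assumes F: "twice_continuously_differentiable_on (\<lambda>(t, v). F t v) ({0..} \<times> UNIV)" and t: "0 \<le> t"
  shows "bounded_linear (frechet_derivative (\<lambda>x. F t x) (at v))"
proof -
  let ?S = "{0..} \<times> (UNIV :: (real ^ 'n) set)"
  from F obtain F' :: "real \<times> (real ^ 'n) \<Rightarrow> (real \<times> (real ^ 'n)) \<Rightarrow>\<^sub>L (real ^ 'n)" where
    F': "\<And>x. x \<in> ?S \<Longrightarrow> ((\<lambda>(t, v). F t v) has_derivative blinfun_apply (F' x)) (at x within ?S)"
    unfolding twice_continuously_differentiable_on_def by blast
  have "((\<lambda>x. F t x) has_derivative (\<lambda>x. F' (t, v) (0, x))) (at v)"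
    by (rule has_derivative_partial_snd[OF F']) (use t in auto)
  then have "(\<lambda>x. F t x) differentiable at v" by (auto simp: differentiable_def)
  then show ?thesis
    by (auto simp: frechet_derivative_works dest: has_derivative_bounded_linear)
qed

text \<open>Along a curve that leaves \<open>v\<close> with velocity \<open>c *\<^sub>R g\<close>, the vector field changes at the rate
\<open>c\<close> times its total derivative along the flow. The deviation of \<open>w\<close> from the straight line enters
through a bounded linear map, so its order is preserved as long as it does not exceed the order
\<open>2\<close> of the Taylor remainder; order \<open>1\<close> serves to start the bootstrap for the exact solution. The
factor \<open>c\<close> is \<open>1\<close> for the solution and \<open>j\<close> for the value after \<open>j\<close> substeps.\<close>

lemma semilinear_rhs_expansion:
  fixes F :: "real \<Rightarrow> real ^ 'n \<Rightarrow> real ^ 'n" and L :: "real ^ 'n ^ 'n" and v :: "real ^ 'n"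
  assumes F: "twice_continuously_differentiable_on (\<lambda>(t, v). F t v) ({0..} \<times> UNIV)"
    and t: "0 \<le> t" and c: "0 \<le> c"
  defines "g \<equiv> semilinear_rhs L F t v"
  assumes k: "1 \<le> k" "k \<le> 2"
    and w: "vanishes_to_order k (\<lambda>h. w h - v - (c * h) *\<^sub>R g)"
  shows "vanishes_to_order k (\<lambda>h. semilinear_rhs L F (t + c * h) (w h) - g
           - (c * h) *\<^sub>R (L *v g + total_derivative L F t v))"
proof -
  let ?Dt = "vector_derivative (\<lambda>s. F s v) (at t within {0..})"
  let ?Dv = "frechet_derivative (\<lambda>x. F t x) (at v)"
  define r where "r h = w h - v - (c * h) *\<^sub>R g" for h
  have r: "vanishes_to_order k r" using w unfolding r_def .
  have "vanishes_to_order 1 (\<lambda>h. r h + h *\<^sub>R (c *\<^sub>R g))"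
    by (intro vanishes_to_order_add vanishes_to_order_linear vanishes_to_order_mono[OF r] k)
  then have "vanishes_to_order 1 (\<lambda>h. w h - v)"
    by (simp add: r_def mult.commute)
  note F_exp = vanishes_to_order_mono[OF nonlinearity_expansion[OF F t c this] k(2)]
  interpret Dv: bounded_linear ?Dv
    by (rule frechet_derivative_bounded_linear_of_C2[OF F t])
  have "vanishes_to_order k (\<lambda>h. (F (t + c * h) (w h) - F t v - (c * h) *\<^sub>R ?Dt - ?Dv (w h - v))
          + (?Dv (r h) + L *v r h))"
    by (intro vanishes_to_order_add F_exp vanishes_to_order_bounded_linear[OF _ r]
          Dv.bounded_linear_axioms matrix_vector_mul_bounded_linear)
  moreover have "semilinear_rhs L F (t + c * h) (w h) - g
      - (c * h) *\<^sub>R (L *v g + total_derivative L F t v) =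
      (F (t + c * h) (w h) - F t v - (c * h) *\<^sub>R ?Dt - ?Dv (w h - v)) + (?Dv (r h) + L *v r h)" for h
  proof -
    have "F t v = g - L *v v" by (simp add: g_def semilinear_rhs_def)
    then show ?thesis
      unfolding r_def total_derivative_def g_def[symmetric]
        semilinear_rhs_def[of L F "t + c * h" "w h"]
      by (simp add: Dv.diff Dv.add Dv.scaleR matrix_vector_mult_diff_distrib algebra_simps)
  qed
  ultimately show ?thesis by simp
qed

text \<open>A bootstrap: differentiability at the initial time gives an expansion with error of order \<open>1\<close>;
inserting an expansion into the differential equation and integrating gains one order each time.\<close>

lemma exact_solution_expansion:
  fixes F :: "real \<Rightarrow> real ^ 'n \<Rightarrow> real ^ 'n" and L :: "real ^ 'n ^ 'n" and u :: "real \<Rightarrow> real ^ 'n"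
  assumes F: "twice_continuously_differentiable_on (\<lambda>(t, v). F t v) ({0..} \<times> UNIV)"
    and t: "0 \<le> t" and T: "0 < T"
    and u: "\<And>s. s \<in> {t..<t + T} \<Longrightarrow>
          (u has_vector_derivative semilinear_rhs L F s (u s)) (at s within {t..<t + T})"
  defines "g \<equiv> semilinear_rhs L F t (u t)"
  shows "vanishes_to_order 3 (\<lambda>h. u (t + h) - u t - h *\<^sub>R g
           - (h ^ 2 / 2) *\<^sub>R (L *v g + total_derivative L F t (u t)))"
proof -
  define w where "w h = u (t + h)" for h
  define q where "q = L *v g + total_derivative L F t (u t)"
  have w': "(w has_vector_derivative semilinear_rhs L F (t + h) (w h)) (at h within {0..<T})"
    if "h \<in> {0..<T}" for h
  proof -
    have "(+) t ` {0..<T} = {t..<t + T}" by (simp add: add.commute)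
    then have "((u \<circ> (+) t) has_vector_derivative (1 *\<^sub>R semilinear_rhs L F (t + h) (w h)))
      (at h within {0..<T})"
      using that u[of "t + h"] unfolding w_def
      by (intro vector_diff_chain_within) (auto intro!: derivative_eq_intros)
    then show ?thesis by (simp add: w_def[abs_def] comp_def)
  qed
  have "(w has_derivative (\<lambda>x. x *\<^sub>R g)) (at 0 within {0..<T})"
    using w'[of 0] T by (simp add: has_vector_derivative_def g_def w_def)
  \<comment> \<open>At this stage any fixed tolerance serves in the definition of the derivative; it is
    taken to be \<open>1\<close>.\<close>
  then have "\<exists>d>0. \<forall>y\<in>{0..<T}. norm (y - 0) < d \<longrightarrow>
      norm (w y - w 0 - (y - 0) *\<^sub>R g) \<le> 1 * norm (y - 0)"
    unfolding has_derivative_within_alt by (metis zero_less_one)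
  then obtain d where d: "d > 0" "\<And>y. y \<in> {0..<T} \<Longrightarrow> \<bar>y\<bar> < d \<Longrightarrow> norm (w y - w 0 - y *\<^sub>R g) \<le> \<bar>y\<bar>"
    by auto
  have "eventually (\<lambda>h. norm (w h - w 0 - h *\<^sub>R g) \<le> 1 * h ^ 1) (at_right 0)"
    unfolding eventually_at_right_field using d T by (intro exI[of _ "min d T"]) auto
  then have ord1: "vanishes_to_order 1 (\<lambda>h. w h - w 0 - h *\<^sub>R g)"
    by (rule vanishes_to_orderI)
  have rhs: "vanishes_to_order k (\<lambda>h. semilinear_rhs L F (t + h) (w h) - g - h *\<^sub>R q)"
    if "1 \<le> k" "k \<le> 2" "vanishes_to_order k (\<lambda>h. w h - w 0 - h *\<^sub>R g)" for k
    using semilinear_rhs_expansion[OF F t, of 1 k w "u t" L] that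
    by (simp add: q_def g_def w_def)
  have "vanishes_to_order 1 (\<lambda>h. (semilinear_rhs L F (t + h) (w h) - g - h *\<^sub>R q) + h *\<^sub>R q)"
    by (intro vanishes_to_order_add rhs ord1 vanishes_to_order_linear) simp_all
  then have "vanishes_to_order 1 (\<lambda>h. semilinear_rhs L F (t + h) (w h) - g)" by simp
  then have "vanishes_to_order (Suc 1) (\<lambda>h. w h - w 0 - h *\<^sub>R g)"
    by (rule vanishes_to_order_integrate[OF T, rotated 2])
       (auto intro!: derivative_eq_intros w')
  then have ord2: "vanishes_to_order 2 (\<lambda>h. w h - w 0 - h *\<^sub>R g)" by (simp add: numeral_2_eq_2)
  have "vanishes_to_order 2 (\<lambda>h. semilinear_rhs L F (t + h) (w h) - g - h *\<^sub>R q)"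
    using ord2 by (intro rhs) simp_all
  then have "vanishes_to_order (Suc 2) (\<lambda>h. w h - w 0 - h *\<^sub>R g - (h ^ 2 / 2) *\<^sub>R q)"
    by (rule vanishes_to_order_integrate[OF T, rotated 2])
       (auto intro!: derivative_eq_intros w')
  then show ?thesis by (simp add: w_def q_def numeral_3_eq_3 numeral_2_eq_2)
qed

section \<open>The exact and the projected propagator for small steps\<close>

lemma bounded_bilinear_matrix_mult:
  "bounded_bilinear ((**) :: real ^ 'n ^ 'm \<Rightarrow> real ^ 'p ^ 'n \<Rightarrow> real ^ 'p ^ 'm)"
proof -
  have "bilinear ((**) :: real ^ 'n ^ 'm \<Rightarrow> real ^ 'p ^ 'n \<Rightarrow> real ^ 'p ^ 'm)"
    unfolding bilinear_def
    by (auto intro!: linearI simp: vec_eq_iff matrix_matrix_mult_def sum.distrib sum_distrib_left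
        algebra_simps)
  then show ?thesis by (simp add: bilinear_conv_bounded_bilinear)
qed

lemma bounded_bilinear_matrix_vector_mult:
  "bounded_bilinear ((*v) :: real ^ 'n ^ 'm \<Rightarrow> real ^ 'n \<Rightarrow> real ^ 'm)"
proof -
  have "bilinear ((*v) :: real ^ 'n ^ 'm \<Rightarrow> real ^ 'n \<Rightarrow> real ^ 'm)"
    unfolding bilinear_def
    by (auto intro!: linearI simp: vec_eq_iff matrix_vector_mult_def sum.distrib sum_distrib_left
        algebra_simps)
  then show ?thesis by (simp add: bilinear_conv_bounded_bilinear)
qed

lemma matrix_power_scaleR: "matrix_power (c *\<^sub>R A) k = c ^ k *\<^sub>R matrix_power A k"
  by (induction k)
     (simp_all add: bounded_bilinear.scaleR_left[OF bounded_bilinear_matrix_mult]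
        bounded_bilinear.scaleR_right[OF bounded_bilinear_matrix_mult])

text \<open>Some multiple of the norm is submultiplicative for the matrix product, which compares the series
with that of the real exponential function.\<close>

lemma summable_norm_phi1:
  fixes A :: "real ^ 'n ^ 'n"
  shows "summable (\<lambda>k. norm ((1 / fact (k + 1)) *\<^sub>R matrix_power A k))"
proof -
  obtain K where K: "K \<ge> 0" "\<And>(X :: real ^ 'n ^ 'n) (Y :: real ^ 'n ^ 'n). norm (X ** Y) \<le> norm X * norm Y * K"
    using bounded_bilinear.nonneg_bounded[OF bounded_bilinear_matrix_mult] by blast
  define c where "c = norm (mat 1 :: real ^ 'n ^ 'n)"
  have pow: "norm (matrix_power A k) \<le> c * (norm A * K) ^ k" for k
  proof (induction k)
    case (Suc k)
    have "norm (A ** matrix_power A k) \<le> norm A * norm (matrix_power A k) * K" by (rule K(2))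
    also have "\<dots> \<le> norm A * (c * (norm A * K) ^ k) * K"
      using Suc K(1) by (intro mult_left_mono mult_right_mono) auto
    finally show ?case by (simp add: algebra_simps)
  qed (simp add: c_def)
  show ?thesis
  proof (rule summable_comparison_test')
    show "summable (\<lambda>k. c * (inverse (fact k) * (norm A * K) ^ k))"
      by (intro summable_mult summable_exp)
    fix k
    have "norm (matrix_power A k) / fact (k + 1) \<le> (c * (norm A * K) ^ k) / fact k"
      using K(1) by (intro frac_le pow fact_mono) (auto simp: c_def)
    then show "norm (norm ((1 / fact (k + 1)) *\<^sub>R matrix_power A k))
        \<le> c * (inverse (fact k) * (norm A * K) ^ k)"
      by (simp add: field_simps)
  qed
qed

text \<open>For \<open>h < 1\<close> the tail of the series after two terms is at most \<open>h ^ 2\<close> times the sum of the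
norms of its terms at \<open>h = 1\<close>, since every exponent in it is at least \<open>2\<close>.\<close>

lemma phi1_expansion:
  fixes A :: "real ^ 'n ^ 'n"
  shows "vanishes_to_order 2 (\<lambda>h. phi1 (h *\<^sub>R A) - mat 1 - (h / 2) *\<^sub>R A)"
proof -
  define a where "a B k = (1 / fact (k + 1)) *\<^sub>R matrix_power B k" for B :: "real ^ 'n ^ 'n" and k
  have summ: "summable (\<lambda>k. norm (a B (k + 2)))" "summable (\<lambda>k. norm (a B k))" for B
  proof -
    show "summable (\<lambda>k. norm (a B k))" unfolding a_def by (rule summable_norm_phi1)
    then show "summable (\<lambda>k. norm (a B (k + 2)))" by (rule summable_ignore_initial_segment)
  qed
  have scale: "a (h *\<^sub>R A) k = h ^ k *\<^sub>R a A k" for h k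
    by (simp add: a_def matrix_power_scaleR)
  have tail: "phi1 (h *\<^sub>R A) - mat 1 - (h / 2) *\<^sub>R A = (\<Sum>k. a (h *\<^sub>R A) (k + 2))" for h
  proof -
    have "phi1 (h *\<^sub>R A) = (\<Sum>k. a (h *\<^sub>R A) (k + 2)) + (\<Sum>k<2. a (h *\<^sub>R A) k)"
      unfolding phi1_def a_def[symmetric]
      by (rule suminf_split_initial_segment[OF summable_norm_cancel[OF summ(2)]])
    then show ?thesis
      by (simp add: numeral_2_eq_2 scale) (simp add: a_def fact_numeral)
  qed
  have "norm (\<Sum>k. a (h *\<^sub>R A) (k + 2)) \<le> (\<Sum>k. norm (a A (k + 2))) * h ^ 2" if h: "0 < h" "h < 1" for h
  proof -
    have "norm (\<Sum>k. a (h *\<^sub>R A) (k + 2)) \<le> (\<Sum>k. norm (a (h *\<^sub>R A) (k + 2)))"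
      by (rule summable_norm[OF summ(1)])
    also have "\<dots> \<le> (\<Sum>k. norm (a A (k + 2)) * h ^ 2)"
    proof (rule suminf_le)
      fix k
      have "h ^ (k + 2) \<le> h ^ 2" using h by (intro power_decreasing) auto
      then have "h ^ (k + 2) * norm (a A (k + 2)) \<le> h ^ 2 * norm (a A (k + 2))"
        by (intro mult_right_mono) auto
      then show "norm (a (h *\<^sub>R A) (k + 2)) \<le> norm (a A (k + 2)) * h ^ 2"
        using h unfolding scale by (simp add: mult.commute)
    qed (intro summ summable_mult2)+
    also have "\<dots> = (\<Sum>k. norm (a A (k + 2))) * h ^ 2"
      by (rule suminf_mult2[symmetric, OF summ(1)])
    finally show ?thesis .
  qed
  then have "eventually (\<lambda>h. norm (phi1 (h *\<^sub>R A) - mat 1 - (h / 2) *\<^sub>R A)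
      \<le> (\<Sum>k. norm (a A (k + 2))) * h ^ 2) (at_right 0)"
    unfolding tail eventually_at_right_field by (intro exI[of _ 1]) auto
  then show ?thesis by (rule vanishes_to_orderI)
qed

lemma scaled_phi1_expansion:
  "vanishes_to_order 3 (\<lambda>h. h *\<^sub>R phi1 (h *\<^sub>R A) - h *\<^sub>R mat 1 - (h ^ 2 / 2) *\<^sub>R A)"
proof -
  have "vanishes_to_order (1 + 2) (\<lambda>h. h *\<^sub>R (phi1 (h *\<^sub>R A) - mat 1 - (h / 2) *\<^sub>R A))"
    using vanishes_to_order_linear[of "1::real"]
    by (intro vanishes_to_order_bounded_bilinear[OF bounded_bilinear_scaleR] phi1_expansion) simp
  moreover have "h *\<^sub>R (phi1 (h *\<^sub>R A) - mat 1 - (h / 2) *\<^sub>R A) =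
      h *\<^sub>R phi1 (h *\<^sub>R A) - h *\<^sub>R mat 1 - (h ^ 2 / 2) *\<^sub>R A" for h
    by (simp add: scaleR_diff_right power2_eq_square)
  ultimately show ?thesis by (simp add: numeral_3_eq_3)
qed

lemma krylov_propagator_expansion:
  fixes L :: "real ^ 'n ^ 'n" and V :: "real ^ 'm ^ 'n"
  defines "P \<equiv> V ** transpose V"
  shows "vanishes_to_order 3
           (\<lambda>h. krylov_propagator L V h - h *\<^sub>R P - (h ^ 2 / 2) *\<^sub>R (P ** L ** P))"
proof -
  let ?H = "projected_matrix L V"
  have lin: "bounded_linear (\<lambda>X. V ** X ** transpose V)"
    by (intro bounded_linear_compose[OF bounded_bilinear.bounded_linear_left[OF bounded_bilinear_matrix_mult]]
          bounded_bilinear.bounded_linear_right[OF bounded_bilinear_matrix_mult])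
  interpret lin: bounded_linear "\<lambda>X. V ** X ** transpose V" by (rule lin)
  have "vanishes_to_order 3 (\<lambda>h. V ** (h *\<^sub>R phi1 (h *\<^sub>R ?H) - h *\<^sub>R mat 1 - (h ^ 2 / 2) *\<^sub>R ?H)
          ** transpose V)"
    by (intro vanishes_to_order_bounded_linear[OF lin] scaled_phi1_expansion)
  then show ?thesis
    by (simp only: lin.diff lin.scaleR)
       (simp add: krylov_propagator_def P_def projected_matrix_def matrix_mul_assoc)
qed

lemma orthonormal_basis_columns_projection:
  assumes V: "orthonormal_basis_columns V W" and x: "x \<in> W"
  shows "(V ** transpose V) *v x = x"
proof -
  have "transpose V ** V = mat 1"
    using V by (simp add: orthonormal_basis_columns_def vec_eq_iff matrix_matrix_mult_def
        transpose_def mat_def column_def inner_vec_def)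
  then have "(V ** transpose V) *v (V *v axis i 1) = V *v axis i 1" for i
    by (simp add: matrix_vector_mul_assoc flip: matrix_mul_assoc)
  then have "(V ** transpose V) *v y = y" if "y \<in> columns V" for y
    using that by (auto simp: columns_def matrix_vector_mul_component matrix_vector_mult_basis)
  moreover have "x \<in> span (columns V)"
    using V x by (simp add: orthonormal_basis_columns_def)
  ultimately show ?thesis
    by (intro linear_eq_on_span[of "(*v) (V ** transpose V)" "\<lambda>x. x" "columns V" x])
       (auto intro: module_hom_ident)
qed

text \<open>The two propagators applied to \<open>g\<close> agree in the coefficient of \<open>h\<close> because \<open>P *v g = g\<close>, and
the coefficients of \<open>h ^ 2 / 2\<close> are \<open>P *v (L *v g)\<close> and \<open>L *v g\<close>. An error of order \<open>3\<close> forces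
these to coincide.\<close>

lemma krylov_error_imp_invariant:
  fixes L :: "real ^ 'n ^ 'n" and V :: "real ^ 'm ^ 'n"
  defines "P \<equiv> V ** transpose V"
  assumes Pg: "P *v g = g"
    and err: "vanishes_to_order 3 (\<lambda>h. krylov_propagator L V h *v g - exact_propagator L h *v g)"
  shows "P *v (L *v g) = L *v g"
proof -
  note applied = vanishes_to_order_bounded_linear[OF bounded_bilinear.bounded_linear_left[OF
      bounded_bilinear_matrix_vector_mult, of g]]
  have K: "vanishes_to_order 3
      (\<lambda>h. (krylov_propagator L V h - h *\<^sub>R P - (h ^ 2 / 2) *\<^sub>R (P ** L ** P)) *v g)"
    unfolding P_def by (rule applied[OF krylov_propagator_expansion])
  have E: "vanishes_to_order 3
      (\<lambda>h. (exact_propagator L h - h *\<^sub>R mat 1 - (h ^ 2 / 2) *\<^sub>R L) *v g)"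
    unfolding exact_propagator_def by (rule applied[OF scaled_phi1_expansion])
  have "vanishes_to_order 3 (\<lambda>h.
      (krylov_propagator L V h *v g - exact_propagator L h *v g)
      + (exact_propagator L h - h *\<^sub>R mat 1 - (h ^ 2 / 2) *\<^sub>R L) *v g
      - (krylov_propagator L V h - h *\<^sub>R P - (h ^ 2 / 2) *\<^sub>R (P ** L ** P)) *v g)"
    by (intro vanishes_to_order_add vanishes_to_order_diff err K E)
  moreover have "(krylov_propagator L V h *v g - exact_propagator L h *v g)
      + (exact_propagator L h - h *\<^sub>R mat 1 - (h ^ 2 / 2) *\<^sub>R L) *v g
      - (krylov_propagator L V h - h *\<^sub>R P - (h ^ 2 / 2) *\<^sub>R (P ** L ** P)) *v g =
      h ^ 2 *\<^sub>R ((1 / 2) *\<^sub>R (P *v (L *v g) - L *v g))" for h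
  proof -
    have "(P ** L ** P) *v g = P *v (L *v g)"
      using Pg by (simp flip: matrix_vector_mul_assoc)
    then show ?thesis
      using Pg by (simp add: matrix_vector_mult_diff_rdistrib scaleR_diff_right
          flip: scaleR_matrix_vector_assoc)
  qed
  ultimately have "vanishes_to_order (Suc 2) (\<lambda>h. h ^ 2 *\<^sub>R ((1 / 2) *\<^sub>R (P *v (L *v g) - L *v g)))"
    by (simp add: numeral_3_eq_3 numeral_2_eq_2)
  then show ?thesis
    unfolding vanishes_to_order_Suc_power_iff by simp
qed

section \<open>The recycling scheme\<close>

text \<open>Induction on the number of substeps, for the expansion of the value after \<open>j\<close> of them. The next
substep applies \<open>h *\<^sub>R P + (h ^ 2 / 2) *\<^sub>R (P ** L ** P)\<close> to \<open>g + (j * h) *\<^sub>R (L *v g + D)\<close>, so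
that it adds \<open>h *\<^sub>R g\<close> and \<open>h ^ 2 *\<^sub>R ((1 / 2 + j) *\<^sub>R (L *v g) + j *\<^sub>R (P *v D))\<close>. The
coefficients of \<open>L *v g\<close> are half the differences of consecutive squares and thus add up as in
the exact solution. The change \<open>D\<close> of the nonlinearity is seen only through \<open>P\<close> and with the weights \<open>0 + 1 + \<dots> + (j - 1)\<close>,
because each substep freezes the nonlinearity at its left end point.\<close>

lemma recycled_substep_expansion:
  fixes L :: "real ^ 'n ^ 'n" and F :: "real \<Rightarrow> real ^ 'n \<Rightarrow> real ^ 'n"
    and v :: "real ^ 'n" and V :: "real ^ 'm ^ 'n"
  assumes F: "twice_continuously_differentiable_on (\<lambda>(t, v). F t v) ({0..} \<times> UNIV)"
    and t: "0 \<le> t"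
  defines "g \<equiv> semilinear_rhs L F t v" and "D \<equiv> total_derivative L F t v"
    and "P \<equiv> V ** transpose V"
  assumes Pg: "P *v g = g" and PLg: "P *v (L *v g) = L *v g"
  shows "vanishes_to_order 3 (\<lambda>h. recycled_substep L F t v V h j - v - (real j * h) *\<^sub>R g
           - (h ^ 2 / 2) *\<^sub>R ((real j) ^ 2 *\<^sub>R (L *v g) + (real j * (real j - 1)) *\<^sub>R (P *v D)))"
proof (induction j)
  case 0
  show ?case by (simp add: vanishes_to_order_def)
next
  case (Suc j)
  define w where "w h = recycled_substep L F t v V h j" for h
  define q where "q = L *v g + D"
  define rhs where "rhs h = semilinear_rhs L F (t + real j * h) (w h)" for h
  define K where "K h = krylov_propagator L V h" for h
  define e where "e h = w h - v - (real j * h) *\<^sub>R g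
      - (h ^ 2 / 2) *\<^sub>R ((real j) ^ 2 *\<^sub>R (L *v g) + (real j * (real j - 1)) *\<^sub>R (P *v D))" for h
  have e: "vanishes_to_order 3 e" using Suc.IH unfolding e_def w_def .
  have "vanishes_to_order 2 (\<lambda>h. e h
      + h ^ 2 *\<^sub>R ((1 / 2) *\<^sub>R ((real j) ^ 2 *\<^sub>R (L *v g) + (real j * (real j - 1)) *\<^sub>R (P *v D))))"
    by (intro vanishes_to_order_add vanishes_to_order_power vanishes_to_order_mono[OF e]) simp
  then have "vanishes_to_order 2 (\<lambda>h. w h - v - (real j * h) *\<^sub>R g)"
    by (simp add: e_def)
  then have rhs2: "vanishes_to_order 2 (\<lambda>h. rhs h - g - (real j * h) *\<^sub>R q)"
    unfolding rhs_def q_def g_def D_def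
    by (intro semilinear_rhs_expansion[OF F t]) auto
  have "vanishes_to_order 1 (\<lambda>h. (rhs h - g - (real j * h) *\<^sub>R q) + h *\<^sub>R (real j *\<^sub>R q))"
    by (intro vanishes_to_order_add vanishes_to_order_linear vanishes_to_order_mono[OF rhs2]) simp
  then have rhs1: "vanishes_to_order 1 (\<lambda>h. rhs h - g)"
    by (simp add: mult.commute)
  have "vanishes_to_order 0 (\<lambda>h. (rhs h - g) + g)"
    by (intro vanishes_to_order_add vanishes_to_order_const vanishes_to_order_mono[OF rhs1]) simp
  then have rhs0: "vanishes_to_order 0 rhs" by simp
  have K: "vanishes_to_order 3 (\<lambda>h. K h - h *\<^sub>R P - (h ^ 2 / 2) *\<^sub>R (P ** L ** P))"
    unfolding K_def P_def by (rule krylov_propagator_expansion)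
  \<comment> \<open>The increment differs from its terms with \<open>h\<close> and \<open>h ^ 2\<close> by three remainders, each of
    total order \<open>3\<close>.\<close>
  have a: "vanishes_to_order (3 + 0) (\<lambda>h. (K h - h *\<^sub>R P - (h ^ 2 / 2) *\<^sub>R (P ** L ** P)) *v rhs h)"
    by (rule vanishes_to_order_bounded_bilinear[OF bounded_bilinear_matrix_vector_mult K rhs0])
  have b: "vanishes_to_order (1 + 2) (\<lambda>h. (h *\<^sub>R P) *v (rhs h - g - (real j * h) *\<^sub>R q))"
    by (rule vanishes_to_order_bounded_bilinear[OF bounded_bilinear_matrix_vector_mult
          vanishes_to_order_linear rhs2])
  have c: "vanishes_to_order (2 + 1) (\<lambda>h. (h ^ 2 *\<^sub>R ((1 / 2) *\<^sub>R (P ** L ** P))) *v (rhs h - g))"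
    by (rule vanishes_to_order_bounded_bilinear[OF bounded_bilinear_matrix_vector_mult
          vanishes_to_order_power rhs1])
  have "vanishes_to_order 3 (\<lambda>h. e h + (K h - h *\<^sub>R P - (h ^ 2 / 2) *\<^sub>R (P ** L ** P)) *v rhs h
      + (h *\<^sub>R P) *v (rhs h - g - (real j * h) *\<^sub>R q)
      + (h ^ 2 *\<^sub>R ((1 / 2) *\<^sub>R (P ** L ** P))) *v (rhs h - g))"
    using a b c by (intro vanishes_to_order_add e) (simp_all add: numeral_3_eq_3)
  moreover have "recycled_substep L F t v V h (Suc j) - v - (real (Suc j) * h) *\<^sub>R g
      - (h ^ 2 / 2) *\<^sub>R ((real (Suc j)) ^ 2 *\<^sub>R (L *v g)
          + (real (Suc j) * (real (Suc j) - 1)) *\<^sub>R (P *v D)) =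
      e h + (K h - h *\<^sub>R P - (h ^ 2 / 2) *\<^sub>R (P ** L ** P)) *v rhs h
      + (h *\<^sub>R P) *v (rhs h - g - (real j * h) *\<^sub>R q)
      + (h ^ 2 *\<^sub>R ((1 / 2) *\<^sub>R (P ** L ** P))) *v (rhs h - g)" for h
  proof -
    have "K h *v rhs h = (K h - h *\<^sub>R P - (h ^ 2 / 2) *\<^sub>R (P ** L ** P)) *v rhs h
      + (h *\<^sub>R P) *v (rhs h - g - (real j * h) *\<^sub>R q)
      + (h ^ 2 *\<^sub>R ((1 / 2) *\<^sub>R (P ** L ** P))) *v (rhs h - g)
      + h *\<^sub>R (P *v g) + (h ^ 2 * real j) *\<^sub>R (P *v q) + (h ^ 2 / 2) *\<^sub>R ((P ** L ** P) *v g)"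
      by (simp add: matrix_vector_mult_diff_distrib matrix_vector_mult_diff_rdistrib
          matrix_vector_mult_scaleR scaleR_diff_right power2_eq_square mult_ac
          flip: scaleR_matrix_vector_assoc)
    moreover have "(P ** L ** P) *v g = L *v g"
      using Pg PLg by (simp flip: matrix_vector_mul_assoc)
    moreover have "P *v q = L *v g + P *v D"
      using PLg by (simp add: q_def matrix_vector_right_distrib)
    moreover have "recycled_substep L F t v V h (Suc j) = w h + K h *v rhs h"
      by (simp add: w_def K_def rhs_def)
    moreover have "(h ^ 2 / 2) *\<^sub>R ((real (Suc j)) ^ 2 *\<^sub>R (L *v g)
          + (real (Suc j) * (real (Suc j) - 1)) *\<^sub>R (P *v D)) =
        (h ^ 2 / 2) *\<^sub>R ((real j) ^ 2 *\<^sub>R (L *v g) + (real j * (real j - 1)) *\<^sub>R (P *v D))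
        + (h ^ 2 * real j) *\<^sub>R (L *v g + P *v D) + (h ^ 2 / 2) *\<^sub>R (L *v g)"
    proof -
      have 1: "(h ^ 2 / 2) * (real (Suc j)) ^ 2 = (h ^ 2 / 2) * (real j) ^ 2 + h ^ 2 * real j + h ^ 2 / 2"
        by (simp add: power2_eq_square field_simps)
      have 2: "(h ^ 2 / 2) * (real (Suc j) * (real (Suc j) - 1)) =
          (h ^ 2 / 2) * (real j * (real j - 1)) + h ^ 2 * real j"
        by (simp add: field_simps)
      show ?thesis
        unfolding scaleR_add_right scaleR_scaleR 1 2 scaleR_add_left by (simp add: add_ac)
    qed
    moreover have "(real (Suc j) * h) *\<^sub>R g = (real j * h) *\<^sub>R g + h *\<^sub>R g"
      by (simp add: distrib_right scaleR_add_left)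
    ultimately show ?thesis
      using Pg by (simp add: e_def)
  qed
  ultimately show ?case by simp
qed

section \<open>The local error\<close>

theorem corollary3p6:
  fixes L :: "real ^ 'n ^ 'n"
    and F :: "real \<Rightarrow> real ^ 'n \<Rightarrow> real ^ 'n"
    and u :: "real \<Rightarrow> real ^ 'n"
    and t\<^sub>n T :: real
    and u\<^sub>n g\<^sub>n :: "real ^ 'n"
    and V :: "real ^ 'm ^ 'n"
    and S :: nat
  assumes F_C2: "twice_continuously_differentiable_on (\<lambda>(t, v). F t v) ({0..} \<times> UNIV)"
    and t\<^sub>n_nonneg: "0 \<le> t\<^sub>n"
    and T_pos: "0 < T"
    and solution: "\<And>t. t \<in> {t\<^sub>n..<t\<^sub>n + T} \<Longrightarrow>
          (u has_vector_derivative semilinear_rhs L F t (u t)) (at t within {t\<^sub>n..<t\<^sub>n + T})"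
    and initial: "u t\<^sub>n = u\<^sub>n"
    and g\<^sub>n: "g\<^sub>n = semilinear_rhs L F t\<^sub>n u\<^sub>n"
    and krylov_dim: "dim (krylov_space L g\<^sub>n CARD('m)) = CARD('m)"
    and V: "orthonormal_basis_columns V (krylov_space L g\<^sub>n CARD('m))"
    and krylov_error:
          "(\<lambda>\<tau>. norm (krylov_propagator L V \<tau> *v g\<^sub>n - exact_propagator L \<tau> *v g\<^sub>n))
             \<in> O[at 0](\<lambda>\<tau>. \<tau> ^ 3)"
    and S: "1 \<le> S"
  shows "(\<lambda>\<Delta>t. norm (u (t\<^sub>n + \<Delta>t) - recycled_substep L F t\<^sub>n u\<^sub>n V (\<Delta>t / real S) S))
           \<in> O[at_right 0](\<lambda>\<Delta>t. \<Delta>t ^ 2) \<and>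
         (\<forall>j\<in>{1..S}.
         (\<lambda>\<Delta>t. let \<delta>t = \<Delta>t / real S in
            norm (u (t\<^sub>n + real j * \<delta>t) - recycled_substep L F t\<^sub>n u\<^sub>n V \<delta>t j -
                  ((real j * \<delta>t) ^ 2 / 2) *\<^sub>R
                    ((mat 1 - ((real j - 1) / real j) *\<^sub>R (V ** transpose V))
                       *v total_derivative L F t\<^sub>n u\<^sub>n)))
           \<in> O[at_right 0](\<lambda>\<Delta>t. (\<Delta>t / real S) ^ 3)) \<and>
         (\<lambda>\<Delta>t. let \<delta>t = \<Delta>t / real S in
            norm (u (t\<^sub>n + \<Delta>t) - recycled_substep L F t\<^sub>n u\<^sub>n V \<delta>t S -
                  (\<delta>t ^ 2 / 2) *\<^sub>R
                    (((real S) ^ 2 *\<^sub>R mat 1 - (real S * (real S - 1)) *\<^sub>R (V ** transpose V))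
                       *v total_derivative L F t\<^sub>n u\<^sub>n)))
           \<in> O[at_right 0](\<lambda>\<Delta>t. (\<Delta>t / real S) ^ 3) \<and>
         (\<lambda>\<Delta>t. norm (u (t\<^sub>n + \<Delta>t) - recycled_substep L F t\<^sub>n u\<^sub>n V (\<Delta>t / real S) S -
                  (\<Delta>t ^ 2 / 2) *\<^sub>R
                    ((mat 1 - ((real S - 1) / real S) *\<^sub>R (V ** transpose V))
                       *v total_derivative L F t\<^sub>n u\<^sub>n)))
           \<in> O[at_right 0](\<lambda>\<Delta>t. \<Delta>t ^ 3)"
proof -
  define D where "D = total_derivative L F t\<^sub>n u\<^sub>n"
  define P where "P = V ** transpose V"
  \<comment> \<open>The coefficient of \<open>h ^ 2 / 2\<close> in the error after \<open>j\<close> substeps of length \<open>h\<close>.\<close>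
  define q where "q = (\<lambda>j. (real j) ^ 2 *\<^sub>R D - (real j * (real j - 1)) *\<^sub>R (P *v D))"
  have "g\<^sub>n \<in> krylov_space L g\<^sub>n CARD('m)"
    unfolding krylov_space_def by (intro span_base) (auto intro!: exI[of _ 0])
  then have Pg: "P *v g\<^sub>n = g\<^sub>n"
    unfolding P_def by (rule orthonormal_basis_columns_projection[OF V])
  have "vanishes_to_order 3 (\<lambda>h. krylov_propagator L V h *v g\<^sub>n - exact_propagator L h *v g\<^sub>n)"
    unfolding vanishes_to_order_def
    by (rule landau_o.big.filter_mono[OF _ krylov_error]) (simp add: at_le)
  then have PLg: "P *v (L *v g\<^sub>n) = L *v g\<^sub>n"
    using krylov_error_imp_invariant[of V g\<^sub>n L] Pg by (simp add: P_def)
  have exact: "vanishes_to_order 3 (\<lambda>h. u (t\<^sub>n + h) - u\<^sub>n - h *\<^sub>R g\<^sub>n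
      - (h ^ 2 / 2) *\<^sub>R (L *v g\<^sub>n + D))"
    using exact_solution_expansion[OF F_C2 t\<^sub>n_nonneg T_pos solution]
    by (simp add: initial g\<^sub>n D_def)
  have scheme: "vanishes_to_order 3 (\<lambda>h. recycled_substep L F t\<^sub>n u\<^sub>n V h j - u\<^sub>n - (real j * h) *\<^sub>R g\<^sub>n
      - (h ^ 2 / 2) *\<^sub>R ((real j) ^ 2 *\<^sub>R (L *v g\<^sub>n) + (real j * (real j - 1)) *\<^sub>R (P *v D)))" for j
    using recycled_substep_expansion[OF F_C2 t\<^sub>n_nonneg, where L = L and v = u\<^sub>n and V = V and j = j]
      Pg PLg by (simp add: g\<^sub>n D_def P_def)
  have local_error: "vanishes_to_order 3
      (\<lambda>h. u (t\<^sub>n + real j * h) - recycled_substep L F t\<^sub>n u\<^sub>n V h j - (h ^ 2 / 2) *\<^sub>R q j)"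
    if "1 \<le> j" for j
  proof -
    have "0 < real j" using that by simp
    note diff = vanishes_to_order_diff[OF vanishes_to_order_dilate[OF exact this] scheme[of j]]
    have "(u (t\<^sub>n + real j * h) - u\<^sub>n - (real j * h) *\<^sub>R g\<^sub>n
        - ((real j * h) ^ 2 / 2) *\<^sub>R (L *v g\<^sub>n + D))
      - (recycled_substep L F t\<^sub>n u\<^sub>n V h j - u\<^sub>n - (real j * h) *\<^sub>R g\<^sub>n
        - (h ^ 2 / 2) *\<^sub>R ((real j) ^ 2 *\<^sub>R (L *v g\<^sub>n) + (real j * (real j - 1)) *\<^sub>R (P *v D))) =
      u (t\<^sub>n + real j * h) - recycled_substep L F t\<^sub>n u\<^sub>n V h j - (h ^ 2 / 2) *\<^sub>R q j" for h
    proof -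
      have sq: "(real j * h) ^ 2 / 2 = (h ^ 2 / 2) * (real j) ^ 2"
        by (simp add: power_mult_distrib)
      show ?thesis
        unfolding sq q_def scaleR_add_right scaleR_diff_right scaleR_scaleR by simp
    qed
    with diff show ?thesis by simp
  qed
  have S_pos: "0 < real S" using S by simp
  have refine: "vanishes_to_order k (\<lambda>\<Delta>t. f (\<Delta>t / real S))" if "vanishes_to_order k f"
    for k and f :: "real \<Rightarrow> real ^ 'n"
    using vanishes_to_order_dilate[OF that, of "1 / real S"] S_pos by simp
  have step_power: "(\<lambda>\<Delta>t. norm (f \<Delta>t)) \<in> O[at_right 0](\<lambda>\<Delta>t. (\<Delta>t / real S) ^ 3)"
    if "vanishes_to_order 3 f" for f :: "real \<Rightarrow> real ^ 'n"
    using that S_pos unfolding vanishes_to_order_def by (simp add: power_divide)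
  have error_S: "vanishes_to_order 3 (\<lambda>\<Delta>t. u (t\<^sub>n + \<Delta>t) - recycled_substep L F t\<^sub>n u\<^sub>n V (\<Delta>t / real S) S
      - ((\<Delta>t / real S) ^ 2 / 2) *\<^sub>R q S)"
    using refine[OF local_error[OF S]] S_pos by simp
  have q_matrix: "((real j * h) ^ 2 / 2) *\<^sub>R ((mat 1 - ((real j - 1) / real j) *\<^sub>R P) *v D)
      = (h ^ 2 / 2) *\<^sub>R q j" if "1 \<le> j" for j h
  proof -
    have coeff: "((real j * h) ^ 2 / 2) * ((real j - 1) / real j) = (h ^ 2 / 2) * (real j * (real j - 1))"
      "(real j * h) ^ 2 / 2 = (h ^ 2 / 2) * (real j) ^ 2"
      using that by (simp_all add: power2_eq_square field_simps)
    show ?thesis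
      unfolding q_def matrix_vector_mult_diff_rdistrib scaleR_matrix_vector_assoc[symmetric]
        scaleR_diff_right scaleR_scaleR coeff(1) unfolding coeff(2) by simp
  qed
  have q_matrix': "((real S) ^ 2 *\<^sub>R mat 1 - (real S * (real S - 1)) *\<^sub>R P) *v D = q S"
    by (simp add: q_def matrix_vector_mult_diff_rdistrib flip: scaleR_matrix_vector_assoc)
  have "vanishes_to_order 2 (\<lambda>\<Delta>t. (u (t\<^sub>n + \<Delta>t) - recycled_substep L F t\<^sub>n u\<^sub>n V (\<Delta>t / real S) S
      - ((\<Delta>t / real S) ^ 2 / 2) *\<^sub>R q S) + \<Delta>t ^ 2 *\<^sub>R ((1 / (2 * real S ^ 2)) *\<^sub>R q S))"
    by (intro vanishes_to_order_add vanishes_to_order_power vanishes_to_order_mono[OF error_S]) simp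
  then have second_order:
    "vanishes_to_order 2 (\<lambda>\<Delta>t. u (t\<^sub>n + \<Delta>t) - recycled_substep L F t\<^sub>n u\<^sub>n V (\<Delta>t / real S) S)"
    by (simp add: power_divide mult.commute)
  show ?thesis
    unfolding Let_def D_def[symmetric] P_def[symmetric]
  proof (intro conjI ballI)
    show "(\<lambda>\<Delta>t. norm (u (t\<^sub>n + \<Delta>t) - recycled_substep L F t\<^sub>n u\<^sub>n V (\<Delta>t / real S) S))
        \<in> O[at_right 0](\<lambda>\<Delta>t. \<Delta>t ^ 2)"
      using second_order unfolding vanishes_to_order_def .
  next
    fix j assume "j \<in> {1..S}"
    then have j: "1 \<le> j" by simp
    show "(\<lambda>\<Delta>t. norm (u (t\<^sub>n + real j * (\<Delta>t / real S)) - recycled_substep L F t\<^sub>n u\<^sub>n V (\<Delta>t / real S) j -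
          ((real j * (\<Delta>t / real S)) ^ 2 / 2) *\<^sub>R ((mat 1 - ((real j - 1) / real j) *\<^sub>R P) *v D)))
        \<in> O[at_right 0](\<lambda>\<Delta>t. (\<Delta>t / real S) ^ 3)"
      unfolding q_matrix[OF j] by (intro step_power refine[OF local_error[OF j]])
  next
    show "(\<lambda>\<Delta>t. norm (u (t\<^sub>n + \<Delta>t) - recycled_substep L F t\<^sub>n u\<^sub>n V (\<Delta>t / real S) S -
          ((\<Delta>t / real S) ^ 2 / 2) *\<^sub>R
            (((real S) ^ 2 *\<^sub>R mat 1 - (real S * (real S - 1)) *\<^sub>R P) *v D)))
        \<in> O[at_right 0](\<lambda>\<Delta>t. (\<Delta>t / real S) ^ 3)"
      unfolding q_matrix' by (intro step_power error_S)
  next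
    have "(\<Delta>t ^ 2 / 2) *\<^sub>R ((mat 1 - ((real S - 1) / real S) *\<^sub>R P) *v D)
        = ((\<Delta>t / real S) ^ 2 / 2) *\<^sub>R q S" for \<Delta>t
      using q_matrix[OF S, of "\<Delta>t / real S"] S_pos by simp
    then show "(\<lambda>\<Delta>t. norm (u (t\<^sub>n + \<Delta>t) - recycled_substep L F t\<^sub>n u\<^sub>n V (\<Delta>t / real S) S -
          (\<Delta>t ^ 2 / 2) *\<^sub>R ((mat 1 - ((real S - 1) / real S) *\<^sub>R P) *v D)))
        \<in> O[at_right 0](\<lambda>\<Delta>t. \<Delta>t ^ 3)"
      using error_S unfolding vanishes_to_order_def by simp
  qed
qed

end
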